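(* Let $x\in\mathcal D$, let $g$ be a Riemannian metric on $\mathcal E$, let $\mathrm{Proj}_x^\perp$ be the $g$-orthogonal projector of $\mathcal E$ onto the $g$-normal space $\mathrm N_x\mathcal M_x$, and let $H(x):\mathcal F\to\mathcal F$ be symmetric positive definite. The pseudoinverse normal step $d_N(x)=-\mathrm Dc(x)^{\dagger,g}H(x)c(x)$ depends on the metric $g$ only through the normal space $\mathrm N_x\mathcal M_x$ (through the normal projector $\mathrm{Proj}_x^\perp$). More precisely, $$d_N(x)=-\mathrm{Proj}_x^\perp\,\mathrm Dc(x)^{\dagger,\mathcal E}H(x)c(x).$$
   Context: $\mathcal E,\mathcal F$ are finite-dimensional Euclidean spaces, $m=\dim\mathcal F<\dim\mathcal E$; $c:\mathcal E\to\mathcal F$ is continuously differentiable; $\mathcal D=\{x\in\mathcal E:\operatorname{rank}\mathrm Dc(x)=m\}$; $\mathcal M_x=\{y:c(y)=c(x)\}$, $\mathrm T_x\mathcal M_x=\ker\mathrm Dc(x)$. The metric is $g(\xi,\zeta)=\langle G(x)\xi,\zeta\rangle_{\mathcal E}$ with $G(x)$ symmetric positive definite; $\mathrm N_x\mathcal M_x=\{v\in\mathcal E:g(v,\xi)=0\ \forall\xi\in\mathrm T_x\mathcal M_x\}$. For linear $A:\mathcal E\to\mathcal F$, $A^{*,\mathcal E}$ is the Euclidean adjoint and $A^{*,g}=G(x)^{-1}A^{*,\mathcal E}$ is the $g$-adjoint. $\mathrm Dc(x)^{\dagger,g}=\mathrm Dc(x)^{*,g}(\mathrm Dc(x)\mathrm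 Dc(x)^{*,g})^{-1}$ and $\mathrm Dc(x)^{\dagger,\mathcal E}=\mathrm Dc(x)^{*,\mathcal E}(\mathrm Dc(x)\mathrm Dc(x)^{*,\mathcal E})^{-1}$. *)

theory Defs
  imports "HOL-Analysis.Analysis"
begin

definition continuously_differentiable ::
    "('a::euclidean_space \<Rightarrow> 'b::euclidean_space) \<Rightarrow> bool" where
  "continuously_differentiable c \<longleftrightarrow>
     (\<exists>c' :: 'a \<Rightarrow> 'a \<Rightarrow>\<^sub>L 'b.
        (\<forall>x. (c has_derivative blinfun_apply (c' x)) (at x)) \<and> continuous_on UNIV c')"

abbreviation Dc ::
    "('a::euclidean_space \<Rightarrow> 'b::euclidean_space) \<Rightarrow> 'a \<Rightarrow> 'a \<Rightarrow> 'b" where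
  "Dc c x \<equiv> frechet_derivative c (at x)"

definition regular_points :: "('a::euclidean_space \<Rightarrow> 'b::euclidean_space) \<Rightarrow> 'a set" where
  "regular_points c = {x. dim (range (Dc c x)) = DIM('b)}"

definition sym_pos_def :: "('a::euclidean_space \<Rightarrow> 'a) \<Rightarrow> bool" where
  "sym_pos_def A \<longleftrightarrow>
     linear A \<and> (\<forall>u v. A u \<bullet> v = u \<bullet> A v) \<and> (\<forall>v. v \<noteq> 0 \<longrightarrow> 0 < A v \<bullet> v)"

text \<open>A metric is represented by its field \<open>G\<close> of symmetric positive definite operators.
  No regularity of \<open>G\<close> in the base point is imposed, so metrics of every
  smoothness class are covered.\<close>

definition riemannian_metric :: "('a::euclidean_space \<Rightarrow> 'a \<Rightarrow> 'a) \<Rightarrow> bool" where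
  "riemannian_metric G \<longleftrightarrow> (\<forall>x. sym_pos_def (G x))"

definition metric_inner :: "('a::euclidean_space \<Rightarrow> 'a \<Rightarrow> 'a) \<Rightarrow> 'a \<Rightarrow> 'a \<Rightarrow> 'a \<Rightarrow> real" where
  "metric_inner G x \<xi> \<zeta> = G x \<xi> \<bullet> \<zeta>"

text \<open>The tangent space at \<open>x\<close> of the level set \<open>{y. c y = c x}\<close>, taken to be the kernel of
  the derivative.\<close>

definition tangent_space_at ::
    "('a::euclidean_space \<Rightarrow> 'b::euclidean_space) \<Rightarrow> 'a \<Rightarrow> 'a set" where
  "tangent_space_at c x = {\<xi>. Dc c x \<xi> = 0}"

definition normal_space_at ::
    "('a::euclidean_space \<Rightarrow> 'b::euclidean_space) \<Rightarrow> ('a \<Rightarrow> 'a \<Rightarrow> 'a) \<Rightarrow> 'a \<Rightarrow> 'a set" where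
  "normal_space_at c G x = {v. \<forall>\<xi>\<in>tangent_space_at c x. metric_inner G x v \<xi> = 0}"

definition metric_projector ::
    "('a::euclidean_space \<Rightarrow> 'a \<Rightarrow> 'a) \<Rightarrow> 'a \<Rightarrow> 'a set \<Rightarrow> 'a \<Rightarrow> 'a" where
  "metric_projector G x S v = (THE p. p \<in> S \<and> (\<forall>w\<in>S. metric_inner G x (v - p) w = 0))"

definition normal_projector ::
    "('a::euclidean_space \<Rightarrow> 'b::euclidean_space) \<Rightarrow> ('a \<Rightarrow> 'a \<Rightarrow> 'a) \<Rightarrow> 'a \<Rightarrow> 'a \<Rightarrow> 'a" where
  "normal_projector c G x = metric_projector G x (normal_space_at c G x)"

text \<open>The codomain keeps its Euclidean inner product, so only the metric on the domain enters.\<close>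

definition metric_adjoint ::
    "('a::euclidean_space \<Rightarrow> 'a \<Rightarrow> 'a) \<Rightarrow> 'a \<Rightarrow> ('a \<Rightarrow> 'b::euclidean_space) \<Rightarrow> 'b \<Rightarrow> 'a" where
  "metric_adjoint G x A = inv (G x) \<circ> adjoint A"

definition metric_pinv ::
    "('a::euclidean_space \<Rightarrow> 'a \<Rightarrow> 'a) \<Rightarrow> 'a \<Rightarrow> ('a \<Rightarrow> 'b::euclidean_space) \<Rightarrow> 'b \<Rightarrow> 'a" where
  "metric_pinv G x A = metric_adjoint G x A \<circ> inv (A \<circ> metric_adjoint G x A)"

definition euclidean_pinv ::
    "('a::euclidean_space \<Rightarrow> 'b::euclidean_space) \<Rightarrow> 'b \<Rightarrow> 'a" where
  "euclidean_pinv A = adjoint A \<circ> inv (A \<circ> adjoint A)"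

definition normal_step ::
    "('a::euclidean_space \<Rightarrow> 'b::euclidean_space) \<Rightarrow> ('a \<Rightarrow> 'a \<Rightarrow> 'a) \<Rightarrow> ('a \<Rightarrow> 'b \<Rightarrow> 'b) \<Rightarrow>
     'a \<Rightarrow> 'a" where
  "normal_step c G H x = - metric_pinv G x (Dc c x) (H x (c x))"

end

theory Submission
  imports Defs
begin

text \<open>The step \<open>p = - normal_step c G H x\<close> is the only \<open>g\<close>-normal solution of
  \<open>Dc c x p = H x (c x)\<close>. Any other right inverse, such as the Euclidean pseudoinverse, gives a
  solution that differs from \<open>p\<close> by a tangent vector, and the \<open>g\<close>-normal projector removes that
  difference.\<close>

lemma sym_pos_def_inj:
  assumes "sym_pos_def A"
  shows "inj A"
proof -
  have "linear A" and pos: "\<And>v. v \<noteq> 0 \<Longrightarrow> 0 < A v \<bullet> v"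
    using assms by (auto simp: sym_pos_def_def)
  moreover have "v = 0" if "A v = 0" for v
    using pos[of v] that by fastforce
  ultimately show ?thesis
    by (simp add: linear_injective_0)
qed

lemma sym_pos_def_surj:
  assumes "sym_pos_def A"
  shows "surj A"
  using assms sym_pos_def_inj linear_injective_imp_surjective
  by (auto simp: sym_pos_def_def)

lemma metric_inner_self_eq_0:
  assumes "riemannian_metric G" and "metric_inner G x v v = 0"
  shows "v = 0"
  using assms unfolding riemannian_metric_def sym_pos_def_def metric_inner_def
  by (metis less_irrefl)

lemma metric_inner_commute:
  assumes "riemannian_metric G"
  shows "metric_inner G x u v = metric_inner G x v u"
  using assms unfolding riemannian_metric_def sym_pos_def_def metric_inner_def
  by (metis inner_commute)

lemma metric_inner_diff_left:
  assumes "riemannian_metric G"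
  shows "metric_inner G x (u - v) w = metric_inner G x u w - metric_inner G x v w"
  using assms unfolding riemannian_metric_def sym_pos_def_def metric_inner_def
  by (simp add: linear_diff inner_diff_left)

text \<open>The factor \<open>inv (G x)\<close> in the adjoint cancels the \<open>G x\<close> in the
  metric because \<open>G x\<close> is onto; the Euclidean adjoint identity remains.\<close>

lemma metric_inner_metric_adjoint:
  assumes "riemannian_metric G" and "linear A"
  shows "metric_inner G x (metric_adjoint G x A z) v = z \<bullet> A v"
proof -
  have "surj (G x)"
    using assms by (simp add: riemannian_metric_def sym_pos_def_surj)
  then show ?thesis
    using assms by (simp add: metric_inner_def metric_adjoint_def surj_f_inv_f adjoint_clauses)
qed

lemma linear_metric_adjoint:
  assumes "riemannian_metric G" and "linear A"
  shows "linear (metric_adjoint G x A)"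
proof -
  have "linear (G x)" and "inj (G x)"
    using assms(1) sym_pos_def_inj[of "G x"]
    by (simp_all only: riemannian_metric_def) (simp add: sym_pos_def_def)
  then have "linear (inv (G x))"
    by (rule inj_linear_imp_inv_linear)
  then show ?thesis
    unfolding metric_adjoint_def using assms(2) by (intro linear_compose adjoint_linear)
qed

text \<open>Write \<open>B\<close> for the metric adjoint. If \<open>A (B z) = 0\<close>, then g(B
  z, B z) = z \<bullet> A (B z) = 0, so B z = 0. Hence z is orthogonal to the range of
  \<open>A\<close>, which is everything, and z = 0. An injective linear endomorphism is onto, so the
  \<open>inv\<close> inside \<open>metric_pinv\<close> is a genuine right inverse.\<close>

lemma surj_comp_metric_adjoint:
  assumes "riemannian_metric G" and "linear A" and "surj A"
  shows "surj (A \<circ> metric_adjoint G x A)"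
proof -
  let ?B = "metric_adjoint G x A"
  have lin: "linear (A \<circ> ?B)"
    using assms by (intro linear_compose linear_metric_adjoint)
  have "z = 0" if "(A \<circ> ?B) z = 0" for z
  proof -
    have "?B z = 0"
      using that assms
      by (intro metric_inner_self_eq_0[of G x]) (simp_all add: metric_inner_metric_adjoint)
    then have "z \<bullet> A v = 0" for v
      using metric_inner_metric_adjoint[OF assms(1,2), of x z v] assms(1)
      by (simp add: metric_inner_def riemannian_metric_def sym_pos_def_def linear_0)
    then show "z = 0"
      using assms(3) by (metis inner_eq_zero_iff surjD)
  qed
  then show ?thesis
    using lin by (intro linear_injective_imp_surjective) (auto simp only: linear_injective_0)
qed

lemma metric_pinv_right_inverse:
  assumes "riemannian_metric G" and "linear A" and "surj A"
  shows "A (metric_pinv G x A w) = w"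
  using surj_f_inv_f[OF surj_comp_metric_adjoint[OF assms]]
  by (simp add: metric_pinv_def)

text \<open>Every value of the pseudoinverse is a value of the metric adjoint, and the adjoint
  identity moves \<open>A\<close> onto the kernel vector.\<close>

lemma metric_pinv_orthogonal_kernel:
  assumes "riemannian_metric G" and "linear A" and "A \<xi> = 0"
  shows "metric_inner G x (metric_pinv G x A w) \<xi> = 0"
  using assms by (simp add: metric_pinv_def metric_inner_metric_adjoint)

lemma riemannian_metric_id: "riemannian_metric (\<lambda>_ v. v)"
  by (simp add: riemannian_metric_def sym_pos_def_def linear_id[unfolded id_def])

text \<open>With the constant identity metric, the Euclidean case falls under the lemmas on
  \<open>metric_pinv\<close>; the base point \<open>x\<close> is free because this metric is
  constant.\<close>

lemma euclidean_pinv_eq_metric_pinv: "euclidean_pinv A = metric_pinv (\<lambda>_ v. v) x A"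
proof -
  have "inv (\<lambda>v. v) = (\<lambda>v::'a. v)"
    using inv_id by (simp add: id_def)
  then show ?thesis
    by (simp add: euclidean_pinv_def metric_pinv_def metric_adjoint_def comp_def)
qed

lemma normal_space_diff:
  assumes "riemannian_metric G" and "u \<in> normal_space_at c G x" and "v \<in> normal_space_at c G x"
  shows "u - v \<in> normal_space_at c G x"
  using assms by (simp add: normal_space_at_def metric_inner_diff_left)

lemma tangent_normal_eq_0:
  assumes "riemannian_metric G" and "v \<in> tangent_space_at c x" and "v \<in> normal_space_at c G x"
  shows "v = 0"
  using assms(2,3) by (intro metric_inner_self_eq_0[OF assms(1), of x]) (simp add: normal_space_at_def)

text \<open>Here \<open>p\<close> serves as the witness for the definite description: a tangent
  residual is g-orthogonal to all normal vectors by the symmetry of g.\<close>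

lemma normal_projector_eqI:
  assumes G: "riemannian_metric G"
    and p: "p \<in> normal_space_at c G x" and vp: "v - p \<in> tangent_space_at c x"
  shows "normal_projector c G x v = p"
  unfolding normal_projector_def metric_projector_def
proof (rule the_equality)
  have orth: "metric_inner G x (v - p) w = 0" if "w \<in> normal_space_at c G x" for w
    using that vp metric_inner_commute[OF G, of x "v - p" w] by (simp add: normal_space_at_def)
  then show "p \<in> normal_space_at c G x \<and> (\<forall>w\<in>normal_space_at c G x. metric_inner G x (v - p) w = 0)"
    using p by blast
  fix q
  assume q: "q \<in> normal_space_at c G x \<and> (\<forall>w\<in>normal_space_at c G x. metric_inner G x (v - q) w = 0)"
  have N: "q - p \<in> normal_space_at c G x"
    using G p q normal_space_diff by blast
  \<comment> \<open>The difference of the two residuals is \<open>q - p\<close> itself. Both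
    residuals are g-orthogonal to this normal vector, so it is g-orthogonal to itself.\<close>
  have "metric_inner G x (v - p - (v - q)) (q - p) = 0"
    unfolding metric_inner_diff_left[OF G, of x "v - p"] using N orth q by simp
  then have "q - p = 0"
    by (intro metric_inner_self_eq_0[OF G, of x]) simp
  then show "q = p"
    by simp
qed

lemma regular_point_derivative:
  assumes "continuously_differentiable c" and "x \<in> regular_points c"
  shows "linear (Dc c x)" and "surj (Dc c x)"
proof -
  have "c differentiable (at x)"
    using assms(1) by (auto simp: continuously_differentiable_def differentiable_def)
  then show lin: "linear (Dc c x)"
    by (rule linear_frechet_derivative)
  \<comment> \<open>Full dimension only says that the span of the range is everything, so the range
    is first identified with its span.\<close>
  have "subspace (range (Dc c x))"
    using lin by (simp add: linear_subspace_image)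
  then have "span (range (Dc c x)) = range (Dc c x)"
    by (simp only: span_eq_iff)
  moreover have "span (range (Dc c x)) = UNIV"
    using assms(2) by (simp only: regular_points_def dim_eq_full mem_Collect_eq)
  ultimately show "surj (Dc c x)"
    by simp
qed

lemma metric_pinv_normal_space:
  assumes "riemannian_metric G" and "linear (Dc c x)"
  shows "metric_pinv G x (Dc c x) w \<in> normal_space_at c G x"
  using assms by (simp add: normal_space_at_def tangent_space_at_def metric_pinv_orthogonal_kernel)

text \<open>Both pseudoinverses are right inverses of \<open>Dc c x\<close>, so their difference is
  sent to w - w = 0.\<close>

lemma metric_pinv_diff_tangent:
  assumes "riemannian_metric G" and "riemannian_metric G'"
    and "linear (Dc c x)" and "surj (Dc c x)"
  shows "metric_pinv G x (Dc c x) w - metric_pinv G' x (Dc c x) w \<in> tangent_space_at c x"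
  using assms by (simp add: tangent_space_at_def linear_diff metric_pinv_right_inverse)

theorem proposition4p3:
  fixes c :: "'a::euclidean_space \<Rightarrow> 'b::euclidean_space"
    and G :: "'a \<Rightarrow> 'a \<Rightarrow> 'a"
    and H :: "'a \<Rightarrow> 'b \<Rightarrow> 'b"
    and x :: 'a
  assumes "DIM('b) < DIM('a)"
    and "continuously_differentiable c"
    and "x \<in> regular_points c"
    and "riemannian_metric G"
    and "sym_pos_def (H x)"
  shows "normal_step c G H x
           = - normal_projector c G x (euclidean_pinv (Dc c x) (H x (c x)))
       \<and> (\<forall>G'. riemannian_metric G' \<and> normal_space_at c G' x = normal_space_at c G x
             \<longrightarrow> normal_step c G' H x = normal_step c G H x)
       \<and> (\<forall>G'. riemannian_metric G' \<and> normal_projector c G' x = normal_projector c G x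
             \<longrightarrow> normal_step c G' H x = normal_step c G H x)"
proof -
  note D = regular_point_derivative[OF assms(2,3)]
  \<comment> \<open>The formula is proved for every metric, since the claim about equal projectors
    applies it to both \<open>G\<close> and \<open>G'\<close>. The Euclidean solution is the vector
    projected, and the g-normal solution is its projection.\<close>
  have step: "normal_step c G' H x
      = - normal_projector c G' x (euclidean_pinv (Dc c x) (H x (c x)))"
    if "riemannian_metric G'" for G'
    unfolding normal_step_def euclidean_pinv_eq_metric_pinv[of _ x]
    using normal_projector_eqI[OF that metric_pinv_normal_space[OF that D(1)]
        metric_pinv_diff_tangent[OF riemannian_metric_id that D]]
    by simp
  have space: "normal_step c G' H x = normal_step c G H x"
    if G': "riemannian_metric G'" and N: "normal_space_at c G' x = normal_space_at c G x" for G'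
  proof -
    let ?w = "H x (c x)"
    \<comment> \<open>Since the normal spaces agree, both solutions are normal for \<open>G\<close>.
      Their difference is then both tangent and normal, hence zero.\<close>
    have "metric_pinv G' x (Dc c x) ?w \<in> normal_space_at c G x"
      using metric_pinv_normal_space[OF G' D(1)] N by simp
    then have "metric_pinv G' x (Dc c x) ?w - metric_pinv G x (Dc c x) ?w = 0"
      by (rule tangent_normal_eq_0[OF assms(4) metric_pinv_diff_tangent[OF G' assms(4) D]
            normal_space_diff[OF assms(4) _ metric_pinv_normal_space[OF assms(4) D(1)]]])
    then show ?thesis
      by (simp add: normal_step_def)
  qed
  show ?thesis
  proof (intro conjI allI impI; (elim conjE)?)
    show "normal_step c G H x = - normal_projector c G x (euclidean_pinv (Dc c x) (H x (c x)))"
      by (rule step[OF assms(4)])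
  next
    fix G'
    assume "riemannian_metric G'" "normal_space_at c G' x = normal_space_at c G x"
    then show "normal_step c G' H x = normal_step c G H x"
      by (rule space)
  next
    fix G'
    assume "riemannian_metric G'" "normal_projector c G' x = normal_projector c G x"
    then show "normal_step c G' H x = normal_step c G H x"
      \<comment> \<open>After both steps are rewritten by the formula, the metric occurs only inside
        the projector.\<close>
      by (simp only: step assms(4))
  qed
qed

end
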